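(* Let $v\ge 4$ be a multiple of $3$. The hypergraph $K_v^{(3)}-I$ admits a decomposition into tight $6$-cycles if and only if $v\equiv 0,3,6 \pmod{12}$.
   Context: $K_v^{(3)}$ denotes the complete $3$-uniform hypergraph on $v$ vertices (all $3$-element subsets of the vertex set are edges). For $3\mid v$, $K_v^{(3)}-I$ denotes the hypergraph obtained from $K_v^{(3)}$ by deleting the edges of a $1$-factor $I$, i.e. a set of $v/3$ pairwise disjoint triples covering all vertices (the choice of $I$ is irrelevant up to isomorphism). A (3-uniform tight) $k$-cycle is given by a cyclic sequence $v_1,v_2,\dots,v_k$ of $k$ distinct vertices, its edges being the $k$ triples $\{v_i,v_{i+1},v_{i+2}\}$, $i=1,\dots,k$, with indices taken modulo $k$. A decomposition of a hypergraph $\mathcal H$ into $k$-cycles is a collection of $k$-cycles (sub-hypergraphs of $\mathcal H$) whose edge sets partition the edge set of $\mathcal H$. *)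

theory Defs
  imports Main
begin

definition complete3 :: "'a set \<Rightarrow> 'a set set" where
  "complete3 V = {e. e \<subseteq> V \<and> card e = 3}"

definition one_factor :: "'a set \<Rightarrow> 'a set set \<Rightarrow> bool" where
  "one_factor V I \<longleftrightarrow> I \<subseteq> complete3 V \<and>
     (\<forall>e\<in>I. \<forall>f\<in>I. e \<noteq> f \<longrightarrow> e \<inter> f = {}) \<and> \<Union>I = V"

definition tight_cycle_edges :: "'a list \<Rightarrow> 'a set set" where
  "tight_cycle_edges xs =
     {{xs ! i, xs ! ((i + 1) mod length xs), xs ! ((i + 2) mod length xs)} | i. i < length xs}"

definition is_tight_cycle_in :: "nat \<Rightarrow> 'a set \<Rightarrow> 'a set set \<Rightarrow> 'a set set \<Rightarrow> bool" where
  "is_tight_cycle_in k V E C \<longleftrightarrow>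
     (\<exists>xs. length xs = k \<and> distinct xs \<and> set xs \<subseteq> V \<and>
           tight_cycle_edges xs \<subseteq> E \<and> C = tight_cycle_edges xs)"

definition tight_cycle_decomposition :: "nat \<Rightarrow> 'a set \<Rightarrow> 'a set set \<Rightarrow> 'a set set set \<Rightarrow> bool" where
  "tight_cycle_decomposition k V E D \<longleftrightarrow>
     (\<forall>C\<in>D. is_tight_cycle_in k V E C) \<and>
     (\<forall>C\<in>D. \<forall>C'\<in>D. C \<noteq> C' \<longrightarrow> C \<inter> C' = {}) \<and>
     \<Union>D = E"

end

theory Submission
  imports Defs
begin

text \<open>
  Write \<open>v = 3 m\<close>. Counting edges, a decomposition forces \<open>6\<close> to divide \<open>v\<^sup>2 (v - 3) / 6\<close>, that is,
  \<open>m mod 4 \<noteq> 3\<close>.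
  Conversely, call the \<open>m\<close> triples of \<open>I\<close> groups, and sort the edges by the set of groups they meet.
  The edges meeting exactly two given groups form a copy of \<open>K\<^sub>6 - I\<close>, which splits into three cycles.
  If \<open>m mod 4 \<noteq> 3\<close> then the triples of groups can be partitioned into pairs of triples sharing two
  groups: adding four new groups only creates triples that can be paired explicitly.
  The edges belonging to such a pair of triples form a complete tripartite hypergraph
  \<open>K\<^bsub>3,3,6\<^esub>\<close>, which is a union of three copies of \<open>K\<^bsub>3,3,2\<^esub>\<close>, each splitting into three cycles.
\<close>

section \<open>Tilings\<close>

text \<open>A finite partition built one tile at a time, so that tilings of disjoint sets combine by
  induction. The tiles are six-cycles when the elements are edges, and \<open>adjacent_pair\<close>
  when they are triples of groups.\<close>

inductive tileable :: "('b set \<Rightarrow> bool) \<Rightarrow> 'b set \<Rightarrow> bool" for P where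
  empty: "tileable P {}"
| tile: "P C \<Longrightarrow> tileable P E \<Longrightarrow> C \<inter> E = {} \<Longrightarrow> tileable P (C \<union> E)"

lemma tileable_single: "P C \<Longrightarrow> tileable P C"
  using tileable.tile[OF _ tileable.empty, of P C] by simp

lemma tileable_Un:
  assumes "tileable P E" "tileable P F" "E \<inter> F = {}"
  shows "tileable P (E \<union> F)"
  using assms
proof (induction rule: tileable.induct)
  case (tile C E)
  have "tileable P (E \<union> F)" "C \<inter> (E \<union> F) = {}" using tile by auto
  with tile.hyps(1) have "tileable P (C \<union> (E \<union> F))" by (rule tileable.tile)
  then show ?case by (simp add: Un_assoc)
qed simp

lemma tileable_UN:
  assumes "finite A" "\<And>a. a \<in> A \<Longrightarrow> tileable P (F a)"
    and "\<And>a b. a \<in> A \<Longrightarrow> b \<in> A \<Longrightarrow> a \<noteq> b \<Longrightarrow> F a \<inter> F b = {}"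
  shows "tileable P (\<Union>a\<in>A. F a)"
  using assms
proof (induction A rule: finite_induct)
  case (insert x A)
  have "F x \<inter> (\<Union>a\<in>A. F a) = {}"
    using insert.hyps insert.prems(2) by fastforce
  then show ?case
    using insert by (auto intro!: tileable_Un)
qed (simp add: tileable.empty)

lemma tileable_partition:
  assumes "tileable P E"
  obtains D where "\<And>C. C \<in> D \<Longrightarrow> P C" "\<And>C C'. C \<in> D \<Longrightarrow> C' \<in> D \<Longrightarrow> C \<noteq> C' \<Longrightarrow> C \<inter> C' = {}" "\<Union>D = E"
proof -
  have "\<exists>D. (\<forall>C\<in>D. P C) \<and> (\<forall>C\<in>D. \<forall>C'\<in>D. C \<noteq> C' \<longrightarrow> C \<inter> C' = {}) \<and> \<Union>D = E"
    using assms
  proof (induction rule: tileable.induct)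
    case (tile C E)
    then obtain D where D: "\<forall>C\<in>D. P C" "\<forall>C\<in>D. \<forall>C'\<in>D. C \<noteq> C' \<longrightarrow> C \<inter> C' = {}" "\<Union>D = E" by blast
    have "C \<inter> B = {}" "B \<inter> C = {}" if "B \<in> D" for B using that D(3) tile.hyps(3) by auto
    then have "\<forall>A\<in>insert C D. \<forall>B\<in>insert C D. A \<noteq> B \<longrightarrow> A \<inter> B = {}" using D(2) by simp
    moreover have "\<forall>A\<in>insert C D. P A" "\<Union>(insert C D) = C \<union> E" using D tile.hyps(1) by simp_all
    ultimately show ?case by blast
  qed (intro exI[of _ "{}"], simp)
  then obtain D where "\<forall>C\<in>D. P C" "\<forall>C\<in>D. \<forall>C'\<in>D. C \<noteq> C' \<longrightarrow> C \<inter> C' = {}" "\<Union>D = E" by blast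
  then show ?thesis by (intro that[of D]) simp_all
qed

section \<open>Tight 6-cycles\<close>

text \<open>The ambient vertex and edge sets are dropped, so that cycles from different building
  blocks can be put together; \<open>tight_cycle_decomposition_6_iff\<close> restores them.\<close>

definition six_cycle :: "'a set set \<Rightarrow> bool" where
  "six_cycle C \<longleftrightarrow> (\<exists>xs. length xs = 6 \<and> distinct xs \<and> C = tight_cycle_edges xs)"

lemma tight_cycle_edges_6:
  "tight_cycle_edges [a,b,c,d,e,f] = {{a,b,c},{b,c,d},{c,d,e},{d,e,f},{e,f,a},{f,a,b}}"
proof -
  have "{i. i < length [a,b,c,d,e,f]} = {0,1,2,3,4,5}" by auto
  then have "tight_cycle_edges [a,b,c,d,e,f] =
    (\<lambda>i. {[a,b,c,d,e,f] ! i, [a,b,c,d,e,f] ! ((i+1) mod 6), [a,b,c,d,e,f] ! ((i+2) mod 6)}) ` {0,1,2,3,4,5}"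
    unfolding tight_cycle_edges_def setcompr_eq_image by simp
  then show ?thesis by simp
qed

lemma six_cycleI:
  "distinct [a,b,c,d,e,f] \<Longrightarrow> six_cycle {{a,b,c},{b,c,d},{c,d,e},{d,e,f},{e,f,a},{f,a,b}}"
  unfolding six_cycle_def
  by (rule exI[of _ "[a,b,c,d,e,f]"]) (simp only: tight_cycle_edges_6, simp)

lemma six_cycleE:
  assumes "six_cycle C"
  obtains a b c d e f where "distinct [a,b,c,d,e,f]"
    "C = {{a,b,c},{b,c,d},{c,d,e},{d,e,f},{e,f,a},{f,a,b}}"
proof -
  obtain xs where xs: "length xs = 6" "distinct xs" "C = tight_cycle_edges xs"
    using assms unfolding six_cycle_def by blast
  then obtain a b c d e f where "xs = [a,b,c,d,e,f]"
    by (auto simp: length_Suc_conv eval_nat_numeral)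
  with xs that show ?thesis by (simp only: tight_cycle_edges_6)
qed

text \<open>Turns comparison of explicit triples into comparison of points, which distinctness of
  the points then decides.\<close>

lemma triple_eq_iff:
  "{a,b,c} = {d,e,f} \<longleftrightarrow> (a = d \<or> a = e \<or> a = f) \<and> (b = d \<or> b = e \<or> b = f) \<and> (c = d \<or> c = e \<or> c = f)
    \<and> (d = a \<or> d = b \<or> d = c) \<and> (e = a \<or> e = b \<or> e = c) \<and> (f = a \<or> f = b \<or> f = c)"
  by auto

lemma card_six_cycle:
  assumes "six_cycle C" shows "card C = 6"
proof -
  obtain a b c d e f where dist: "distinct [a,b,c,d,e,f]"
    and C: "C = {{a,b,c},{b,c,d},{c,d,e},{d,e,f},{e,f,a},{f,a,b}}"
    using assms by (rule six_cycleE)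
  \<comment> \<open>The reversed list supplies every inequality between the points in the opposite
    orientation.\<close>
  from dist have "distinct (rev [a,b,c,d,e,f])" by (simp only: distinct_rev)
  with dist show ?thesis unfolding C by (simp add: triple_eq_iff)
qed

text \<open>Every vertex of a tight cycle lies on one of its edges, so a cycle whose edges lie in
  \<open>E\<close> automatically stays inside \<open>V\<close>.\<close>

lemma tight_cycle_decomposition_6_iff:
  assumes "\<Union>E \<subseteq> V"
  shows "tight_cycle_decomposition 6 V E D \<longleftrightarrow>
    (\<forall>C\<in>D. six_cycle C) \<and> (\<forall>C\<in>D. \<forall>C'\<in>D. C \<noteq> C' \<longrightarrow> C \<inter> C' = {}) \<and> \<Union>D = E"
proof -
  have "set xs \<subseteq> \<Union>(tight_cycle_edges xs)" for xs :: "'a list"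
  proof
    fix x assume "x \<in> set xs"
    then obtain i where "i < length xs" "x = xs ! i" by (auto simp: in_set_conv_nth)
    then show "x \<in> \<Union>(tight_cycle_edges xs)" unfolding tight_cycle_edges_def by blast
  qed
  then have "is_tight_cycle_in 6 V E C \<longleftrightarrow> six_cycle C" if "C \<subseteq> E" for C
    using assms that unfolding is_tight_cycle_in_def six_cycle_def by blast
  then show ?thesis
    unfolding tight_cycle_decomposition_def by blast
qed

section \<open>Decompositions of the two building blocks\<close>

lemma card_3E:
  assumes "card A = 3" obtains a b c where "A = {a,b,c}" "distinct [a,b,c]"
  using assms by (auto simp: card_3_iff)

text \<open>Opposite edges of a tight cycle on six points are complementary triples. Removing the
  complementary pair \<open>A\<close>, \<open>B\<close> leaves nine such pairs, three for each of
  three cycles.\<close>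

lemma tileable_K6_minus_factor:
  fixes A B :: "'a set"
  assumes "card A = 3" "card B = 3" "A \<inter> B = {}"
  shows "tileable six_cycle (complete3 (A \<union> B) - {A, B})"
proof -
  obtain a b c where A: "A = {a,b,c}" "distinct [a,b,c]" using assms(1) by (rule card_3E)
  obtain d e f where B: "B = {d,e,f}" "distinct [d,e,f]" using assms(2) by (rule card_3E)
  have dist: "distinct [a,b,c,d,e,f]" using A B assms(3) by auto
  then have dist_rev: "distinct (rev [a,b,c,d,e,f])" by (simp only: distinct_rev)
  \<comment> \<open>The vertex sequences are \<open>a b f c d e\<close>, \<open>a c f e b d\<close>
    and \<open>a e c b d f\<close>. Disjointness and inclusion are checked directly; equality then
    follows since both sides have 18 edges.\<close>
  define C1 where "C1 = {{a,b,f},{b,f,c},{f,c,d},{c,d,e},{d,e,a},{e,a,b}}"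
  define C2 where "C2 = {{a,c,f},{c,f,e},{f,e,b},{e,b,d},{b,d,a},{d,a,c}}"
  define C3 where "C3 = {{a,e,c},{e,c,b},{c,b,d},{b,d,f},{d,f,a},{f,a,e}}"
  have cyc: "six_cycle C1" "six_cycle C2" "six_cycle C3"
    unfolding C1_def C2_def C3_def using dist dist_rev by (intro six_cycleI; simp)+
  have disj: "C1 \<inter> C2 = {}" "C1 \<inter> C3 = {}" "C2 \<inter> C3 = {}"
    unfolding C1_def C2_def C3_def using dist dist_rev by (simp_all add: triple_eq_iff)
  have til: "tileable six_cycle (C1 \<union> (C2 \<union> C3))"
    using cyc disj by (intro tileable_Un tileable_single) auto
  have fin: "finite C1" "finite C2" "finite C3"
    unfolding C1_def C2_def C3_def by auto
  have "card (C1 \<union> (C2 \<union> C3)) = 18"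
    using disj fin by (simp add: card_Un_disjoint Int_Un_distrib card_six_cycle cyc)
  moreover have "card (complete3 (A \<union> B) - {A, B}) = 18"
  proof -
    have fin: "finite A" "finite B" using assms by (auto intro: card_ge_0_finite)
    have "A \<noteq> B" using assms by auto
    have "card (A \<union> B) = 6" using assms fin by (simp add: card_Un_disjoint)
    then have "card (complete3 (A \<union> B)) = 6 choose 3"
      unfolding complete3_def using fin n_subsets[of "A \<union> B" 3] by simp
    also have "\<dots> = 20" by (simp add: eval_nat_numeral)
    finally have "card (complete3 (A \<union> B)) = 20" .
    moreover have "{A, B} \<subseteq> complete3 (A \<union> B)" using assms unfolding complete3_def by auto
    ultimately show ?thesis using \<open>A \<noteq> B\<close> by (simp add: card_Diff_subset)
  qed
  moreover have "C1 \<union> (C2 \<union> C3) \<subseteq> complete3 (A \<union> B) - {A, B}"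
    unfolding C1_def C2_def C3_def complete3_def A B using dist dist_rev by (simp add: triple_eq_iff)
  moreover have "finite (complete3 (A \<union> B) - {A, B})"
    unfolding complete3_def A B by auto
  ultimately have "C1 \<union> (C2 \<union> C3) = complete3 (A \<union> B) - {A, B}"
    by (intro card_subset_eq) auto
  with til show ?thesis by simp
qed

definition tripartite :: "'a set \<Rightarrow> 'a set \<Rightarrow> 'a set \<Rightarrow> 'a set set" where
  "tripartite A B C = {{a,b,c} |a b c. a \<in> A \<and> b \<in> B \<and> c \<in> C}"

text \<open>Each cycle visits the classes in the order \<open>A\<close>, \<open>B\<close>,
  \<open>{p,q}\<close> twice around, so any three consecutive vertices meet every class.\<close>

lemma tileable_K332:
  fixes A B :: "'a set"
  assumes "card A = 3" "card B = 3" "A \<inter> B = {}" "p \<noteq> q" "{p,q} \<inter> (A \<union> B) = {}"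
  shows "tileable six_cycle (tripartite A B {p,q})"
proof -
  obtain a b c where A: "A = {a,b,c}" "distinct [a,b,c]" using assms(1) by (rule card_3E)
  obtain d e f where B: "B = {d,e,f}" "distinct [d,e,f]" using assms(2) by (rule card_3E)
  have dist: "distinct [a,b,c,d,e,f,p,q]" using A B assms(3-) by auto
  then have dist_rev: "distinct (rev [a,b,c,d,e,f,p,q])" by (simp only: distinct_rev)
  \<comment> \<open>Each cycle contains two pairs from \<open>A\<close> and \<open>B\<close> with
    both \<open>p\<close> and \<open>q\<close>, and two more with only one of them. The half-used
    pairs \<open>c d\<close>, \<open>a e\<close> and \<open>b f\<close> are each completed by
    another cycle.\<close>
  define C1 where "C1 = {{a,d,q},{d,q,c},{q,c,e},{c,e,p},{e,p,a},{p,a,d}}"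
  define C2 where "C2 = {{b,d,p},{d,p,c},{p,c,f},{c,f,q},{f,q,b},{q,b,d}}"
  define C3 where "C3 = {{a,f,p},{f,p,b},{p,b,e},{b,e,q},{e,q,a},{q,a,f}}"
  have "six_cycle C1" "six_cycle C2" "six_cycle C3"
    unfolding C1_def C2_def C3_def using dist dist_rev by (intro six_cycleI; simp)+
  moreover have "C1 \<inter> C2 = {}" "C1 \<inter> C3 = {}" "C2 \<inter> C3 = {}"
    unfolding C1_def C2_def C3_def using dist dist_rev by (simp_all add: triple_eq_iff)
  ultimately have til: "tileable six_cycle (C1 \<union> (C2 \<union> C3))"
    by (intro tileable_Un tileable_single) auto
  have "tripartite A B {p,q} = (\<Union>x\<in>A. \<Union>y\<in>B. {{x,y,p},{x,y,q}})"
    unfolding tripartite_def by blast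
  also have "\<dots> = C1 \<union> (C2 \<union> C3)"
    unfolding C1_def C2_def C3_def A B by (simp add: insert_commute)
  finally show ?thesis using til by simp
qed

lemma tripartite_Un: "tripartite A B (C \<union> D) = tripartite A B C \<union> tripartite A B D"
  unfolding tripartite_def by blast

text \<open>Edges of the first hypergraph meet \<open>C\<close>, those of the second avoid
  it.\<close>

lemma tripartite_disjoint:
  assumes "C \<inter> D = {}" "C \<inter> (A \<union> B) = {}"
  shows "tripartite A B C \<inter> tripartite A B D = {}"
proof -
  have "x \<inter> C \<noteq> {}" if "x \<in> tripartite A B C" for x
    using that unfolding tripartite_def by auto
  moreover have "x \<inter> C = {}" if "x \<in> tripartite A B D" for x
    using that assms unfolding tripartite_def by auto
  ultimately show ?thesis by blast
qed

lemma tileable_K336: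
  fixes A B C D :: "'a set"
  assumes "card A = 3" "card B = 3" "card C = 3" "card D = 3"
    and "A \<inter> B = {}" "C \<inter> D = {}" "(C \<union> D) \<inter> (A \<union> B) = {}"
  shows "tileable six_cycle (tripartite A B (C \<union> D))"
proof -
  obtain a b c where C: "C = {a,b,c}" "distinct [a,b,c]" using assms(3) by (rule card_3E)
  obtain d e f where D: "D = {d,e,f}" "distinct [d,e,f]" using assms(4) by (rule card_3E)
  \<comment> \<open>The six points are split into three pairs; as \<open>C\<close> and
    \<open>D\<close> have odd size, the pair \<open>{c,d}\<close> straddles them.\<close>
  have "C \<union> D = {a,b} \<union> ({c,d} \<union> {e,f})" unfolding C D by auto
  moreover have "tileable six_cycle (tripartite A B {p,q})" if "(p,q) \<in> {(a,b),(c,d),(e,f)}" for p q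
    using that assms C D by (intro tileable_K332) auto
  moreover have "tripartite A B {a,b} \<inter> tripartite A B ({c,d} \<union> {e,f}) = {}"
    "tripartite A B {c,d} \<inter> tripartite A B {e,f} = {}"
    using assms(6,7) C D by (intro tripartite_disjoint; auto)+
  ultimately have "tileable six_cycle (tripartite A B ({a,b} \<union> ({c,d} \<union> {e,f})))"
    by (simp only: tripartite_Un) (intro tileable_Un; simp)
  with \<open>C \<union> D = _\<close> show ?thesis by simp
qed

section \<open>Pairing the triples of a set\<close>

text \<open>A single triple of groups carries 27 edges, not a multiple of 6; two triples sharing two
  groups carry 54, arranged as K_{3,3,6}.\<close>

definition adjacent_pair :: "'b set set \<Rightarrow> bool" where
  "adjacent_pair Q \<longleftrightarrow> (\<exists>e f. Q = {e, f} \<and> card e = 3 \<and> card f = 3 \<and> card (e \<inter> f) = 2)"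

lemma adjacent_pairI: "distinct [p,q,r,s] \<Longrightarrow> adjacent_pair {{p,q,r},{p,q,s}}"
proof -
  assume dist: "distinct [p,q,r,s]"
  then have "{p,q,r} \<inter> {p,q,s} = {p,q}" by auto
  then have "card ({p,q,r} \<inter> {p,q,s}) = 2" using dist by simp
  then show ?thesis
    unfolding adjacent_pair_def using dist
    by (intro exI[of _ "{p,q,r}"] exI[of _ "{p,q,s}"]) simp
qed

lemma tileable_adjacent_pair4:
  assumes "adjacent_pair {a,b}" "adjacent_pair {c,d}" "distinct [a,b,c,d]"
  shows "tileable adjacent_pair {a,b,c,d}"
proof -
  have "tileable adjacent_pair ({a,b} \<union> {c,d})"
    using assms by (intro tileable_Un tileable_single) auto
  then show ?thesis by (simp only: Un_insert_left Un_empty_left)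
qed

lemma tileable_adjacent_pair6:
  assumes "adjacent_pair {a,b}" "adjacent_pair {c,d}" "adjacent_pair {e,f}" "distinct [a,b,c,d,e,f]"
  shows "tileable adjacent_pair {a,b,c,d,e,f}"
proof -
  have "tileable adjacent_pair {a,b}" using assms(1) by (rule tileable_single)
  moreover have "tileable adjacent_pair {c,d,e,f}"
    using assms by (intro tileable_adjacent_pair4) simp_all
  ultimately have "tileable adjacent_pair ({a,b} \<union> {c,d,e,f})"
    using assms(4) by (intro tileable_Un) auto
  then show ?thesis by (simp only: Un_insert_left Un_empty_left)
qed

text \<open>An explicit list of \<open>k\<close>-subsets is complete as soon as it has the right
  length.\<close>

lemma subsets_of_card_eqI:
  assumes "finite T" "\<And>q. q \<in> F \<Longrightarrow> q \<subseteq> T \<and> card q = k" "card F = card T choose k"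
  shows "{q. q \<subseteq> T \<and> card q = k} = F"
proof (rule card_subset_eq[symmetric])
  show "card F = card {q. q \<subseteq> T \<and> card q = k}" using assms(3) n_subsets[OF assms(1)] by simp
qed (use assms in auto)

text \<open>These are the triples with prescribed part \<open>P\<close> outside the four points
  \<open>T\<close>. There are 4, 6 or 4 of them for \<open>card P\<close> equal to 0, 1 or 2: always
  an even number.\<close>

lemma tileable_triples_over:
  fixes P T :: "'b set"
  assumes "card T = 4" "finite P" "card P \<le> 2" "P \<inter> T = {}"
  shows "tileable adjacent_pair ((\<union>) P ` {q. q \<subseteq> T \<and> card q = 3 - card P})"
proof -
  obtain w x y z where T: "T = {w,x,y,z}" and dist: "distinct [w,x,y,z]"
    using assms(1) by (auto simp: card_Suc_eq eval_nat_numeral)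
  have choose: "4 choose 1 = (4::nat)" "4 choose 2 = (6::nat)" "4 choose 3 = (4::nat)"
    by (simp_all add: eval_nat_numeral)
  from dist have dist_rev: "distinct (rev [w,x,y,z])" by (simp only: distinct_rev)
  have "card P = 0 \<or> card P = 1 \<or> card P = 2" using assms(3) by auto
  then show ?thesis
  proof (elim disjE)
    assume "card P = 0"
    then have P: "P = {}" using assms by simp
    have "{q. q \<subseteq> T \<and> card q = 3} = {{w,x,y},{w,x,z},{w,y,z},{x,y,z}}"
    proof (rule subsets_of_card_eqI)
      show "card {{w,x,y},{w,x,z},{w,y,z},{x,y,z}} = card T choose 3"
        unfolding assms(1) choose using dist dist_rev by (simp add: triple_eq_iff)
    qed (use dist T in auto)
    moreover have "tileable adjacent_pair {{w,x,y},{w,x,z},{w,y,z},{x,y,z}}"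
    proof (rule tileable_adjacent_pair4)
      show "adjacent_pair {{w,x,y},{w,x,z}}" using dist by (intro adjacent_pairI) auto
      have "adjacent_pair {{y,z,w},{y,z,x}}" using dist by (intro adjacent_pairI) auto
      then show "adjacent_pair {{w,y,z},{x,y,z}}" by (simp add: insert_commute)
      show "distinct [{w,x,y},{w,x,z},{w,y,z},{x,y,z}]"
        using dist dist_rev by (simp add: triple_eq_iff)
    qed
    ultimately show ?thesis unfolding P by simp
  next
    assume "card P = 1"
    then obtain s where P: "P = {s}" by (auto simp: card_1_singleton_iff)
    have dist': "distinct [s,w,x,y,z]" using dist assms(4) unfolding P T by auto
    then have dist'_rev: "distinct (rev [s,w,x,y,z])" by (simp only: distinct_rev)
    have "{q. q \<subseteq> T \<and> card q = 2} = {{w,x},{w,y},{w,z},{x,z},{x,y},{y,z}}"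
    proof (rule subsets_of_card_eqI)
      show "card {{w,x},{w,y},{w,z},{x,z},{x,y},{y,z}} = card T choose 2"
        unfolding assms(1) choose using dist dist_rev by (simp add: doubleton_eq_iff)
    qed (use dist T in auto)
    \<comment> \<open>The six edges of the complete graph on \<open>T\<close> split into three paths
      of length two, with middle points \<open>w\<close>, \<open>z\<close> and \<open>y\<close>;
      adding \<open>s\<close> makes the two edges of each path an adjacent pair.\<close>
    moreover have "tileable adjacent_pair {{s,w,x},{s,w,y},{s,w,z},{s,x,z},{s,x,y},{s,y,z}}"
    proof (rule tileable_adjacent_pair6)
      show "adjacent_pair {{s,w,x},{s,w,y}}" using dist' by (intro adjacent_pairI) auto
      have "adjacent_pair {{s,z,w},{s,z,x}}" using dist' by (intro adjacent_pairI) auto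
      then show "adjacent_pair {{s,w,z},{s,x,z}}" by (simp add: insert_commute)
      have "adjacent_pair {{s,y,x},{s,y,z}}" using dist' by (intro adjacent_pairI) auto
      then show "adjacent_pair {{s,x,y},{s,y,z}}" by (simp add: insert_commute)
      show "distinct [{s,w,x},{s,w,y},{s,w,z},{s,x,z},{s,x,y},{s,y,z}]"
        using dist' dist'_rev by (simp add: triple_eq_iff)
    qed
    ultimately show ?thesis unfolding P by simp
  next
    assume "card P = 2"
    then obtain s t where P: "P = {s,t}" "s \<noteq> t" by (auto simp: card_2_iff)
    have dist': "distinct [s,t,w,x,y,z]" using dist assms(4) P(2) unfolding P(1) T by auto
    then have dist'_rev: "distinct (rev [s,t,w,x,y,z])" by (simp only: distinct_rev)
    have "{q. q \<subseteq> T \<and> card q = 1} = {{w},{x},{y},{z}}"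
    proof (rule subsets_of_card_eqI)
      show "card {{w},{x},{y},{z}} = card T choose 1"
        unfolding assms(1) choose using dist by simp
    qed (use T in auto)
    moreover have "tileable adjacent_pair {{s,t,w},{s,t,x},{s,t,y},{s,t,z}}"
    proof (rule tileable_adjacent_pair4)
      show "adjacent_pair {{s,t,w},{s,t,x}}" "adjacent_pair {{s,t,y},{s,t,z}}"
        using dist' by (intro adjacent_pairI; simp)+
      show "distinct [{s,t,w},{s,t,x},{s,t,y},{s,t,z}]"
        using dist' dist'_rev by (simp add: triple_eq_iff)
    qed
    ultimately show ?thesis unfolding P(1) using P(2) by simp
  qed
qed

text \<open>Induction in steps of four points. The bases with 0, 1 or 2 points have no triples,
  while 3 points would leave a single unpaired one.\<close>

lemma tileable_complete3:
  fixes S :: "'b set"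
  assumes "finite S" "card S mod 4 \<noteq> 3"
  shows "tileable adjacent_pair (complete3 S)"
  using assms
proof (induction "card S" arbitrary: S rule: less_induct)
  case less
  show ?case
  proof (cases "card S < 4")
    case True
    with less.prems(2) have "card S \<le> 2" by (cases "card S = 3") auto
    then have "card e \<noteq> 3" if "e \<subseteq> S" for e
      using card_mono[OF less.prems(1) that] by linarith
    then have "complete3 S = {}" by (auto simp: complete3_def)
    then show ?thesis by (simp add: tileable.empty)
  next
    case False
    then obtain T where T: "T \<subseteq> S" "card T = 4" "finite T"
      using obtain_subset_with_card_n[of 4 S] by (metis not_less)
    define R where "R = S - T"
    have R: "finite R" "R \<inter> T = {}" "S = R \<union> T" "card R = card S - 4"
      using T less.prems(1) by (auto simp: R_def card_Diff_subset)
    \<comment> \<open>The triples meeting \<open>T\<close> are sorted by their trace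
      \<open>P\<close> on \<open>R\<close>. Such a trace has at most two points, so
      \<open>3 - card P\<close> is not truncated.\<close>
    define over where "over P = (\<union>) P ` {q. q \<subseteq> T \<and> card q = 3 - card P}" for P
    define small where "small = {P. P \<subseteq> R \<and> card P \<le> 2}"
    have trace: "e \<inter> R = P" if "e \<in> over P" "P \<in> small" for e P
      using that R unfolding over_def small_def by auto
    \<comment> \<open>Removing four points keeps the residue modulo 4.\<close>
    have "tileable adjacent_pair (complete3 R)"
      using less.hyps[of R] less.prems(2) R(1,4) False by (simp add: mod_if[of "card S"])
    moreover have "tileable adjacent_pair (\<Union>P\<in>small. over P)"
    proof (rule tileable_UN)
      show "finite small" using R(1) by (simp add: small_def)
      show "tileable adjacent_pair (over P)" if "P \<in> small" for P
        unfolding over_def using that R T(2) finite_subset[of P R]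
        by (intro tileable_triples_over) (auto simp: small_def)
      show "over P \<inter> over Q = {}" if "P \<in> small" "Q \<in> small" "P \<noteq> Q" for P Q
        using trace that by blast
    qed
    moreover have "complete3 R \<inter> (\<Union>P\<in>small. over P) = {}"
    proof -
      have False if e: "e \<in> complete3 R" "e \<in> over P" "P \<in> small" for e P
      proof -
        have "e = P" using trace[OF e(2,3)] e(1) by (auto simp: complete3_def)
        then show False using e(1,3) by (simp add: complete3_def small_def)
      qed
      then show ?thesis by blast
    qed
    moreover have "complete3 S = complete3 R \<union> (\<Union>P\<in>small. over P)"
    proof (intro equalityI subsetI)
      fix e assume "e \<in> complete3 S"
      then have e: "e \<subseteq> R \<union> T" "card e = 3" using R(3) by (auto simp: complete3_def)
      then have fin: "finite e" by (auto intro: card_ge_0_finite)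
      have split: "e = (e \<inter> R) \<union> (e \<inter> T)" using e by auto
      have "card ((e \<inter> R) \<union> (e \<inter> T)) = card (e \<inter> R) + card (e \<inter> T)"
        using fin R(2) by (intro card_Un_disjoint) auto
      with split e have sum: "card (e \<inter> R) + card (e \<inter> T) = 3" by simp
      show "e \<in> complete3 R \<union> (\<Union>P\<in>small. over P)"
      proof (cases "card (e \<inter> R) \<le> 2")
        case True
        have "e \<in> over (e \<inter> R)"
          unfolding over_def using split sum by (intro image_eqI[of _ _ "e \<inter> T"]) auto
        moreover have "e \<inter> R \<in> small" using True by (simp add: small_def)
        ultimately show ?thesis by blast
      next
        case False
        then have "card (e \<inter> T) = 0" using sum by linarith
        then have "e \<subseteq> R" using fin split by auto
        then show ?thesis using e(2) by (simp add: complete3_def)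
      qed
    next
      fix e assume "e \<in> complete3 R \<union> (\<Union>P\<in>small. over P)"
      then show "e \<in> complete3 S"
      proof
        assume "e \<in> complete3 R"
        then show ?thesis using R(3) by (auto simp: complete3_def)
      next
        assume "e \<in> (\<Union>P\<in>small. over P)"
        then obtain P q where "P \<subseteq> R" "card P \<le> 2" "q \<subseteq> T" "card q = 3 - card P" "e = P \<union> q"
          by (auto simp: small_def over_def)
        moreover from this have "card (P \<union> q) = card P + card q"
          using R(1,2) T(3) finite_subset by (intro card_Un_disjoint) blast+
        ultimately show ?thesis using R(3) by (auto simp: complete3_def)
      qed
    qed
    ultimately show ?thesis by (simp add: tileable_Un)
  qed
qed

text \<open>Absorption applied twice. The product form lets the edge count become a polynomial
  identity without division.\<close>

lemma six_times_choose_3: "6 * (n choose 3) = n * (n - 1) * (n - 2)"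
proof -
  have "3 * (n choose 3) = n * ((n - 1) choose 2)"
    using binomial_absorption[of 2 n] by (simp add: eval_nat_numeral)
  moreover have "2 * ((n - 1) choose 2) = (n - 1) * (n - 2)"
    using binomial_absorption[of 1 "n - 1"] by (simp add: eval_nat_numeral)
  ultimately have "2 * (3 * (n choose 3)) = n * ((n - 1) * (n - 2))" by (metis mult.left_commute)
  then show ?thesis by (simp add: mult.assoc)
qed

section \<open>Sorting edges by the groups they meet\<close>

definition shadow :: "'a set set \<Rightarrow> 'a set \<Rightarrow> 'a set set" where
  "shadow I x = {g \<in> I. g \<inter> x \<noteq> {}}"

text \<open>Indexed by a family of shadows rather than by one shadow: disjoint families give
  disjoint edge sets, so a tiling of the triples of groups carries over to edges.\<close>

definition edges_over :: "'a set \<Rightarrow> 'a set set \<Rightarrow> 'a set set set \<Rightarrow> 'a set set" where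
  "edges_over V I F = {x \<in> complete3 V. shadow I x \<in> F}"

context
  fixes V :: "'a set" and I :: "'a set set"
  assumes fin: "finite V" and factor: "one_factor V I"
begin

lemma group_card: "g \<in> I \<Longrightarrow> card g = 3"
  using factor unfolding one_factor_def complete3_def by auto

lemma group_disjoint: "g \<in> I \<Longrightarrow> h \<in> I \<Longrightarrow> g \<noteq> h \<Longrightarrow> g \<inter> h = {}"
  using factor unfolding one_factor_def by auto

lemma Union_groups: "\<Union>I = V"
  using factor unfolding one_factor_def by auto

lemma finite_group: "g \<in> I \<Longrightarrow> finite g"
  using group_card by (auto intro: card_ge_0_finite)

lemma finite_groups: "finite I"
  using fin Union_groups finite_UnionD by auto

lemma card_vertices: "card V = 3 * card I"
  using card_partition[of I 3] finite_groups Union_groups fin group_card group_disjoint by simp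

lemma subset_Union_shadow: "x \<subseteq> V \<Longrightarrow> x \<subseteq> \<Union>(shadow I x)"
  using Union_groups unfolding shadow_def by blast

text \<open>A triple inside \<open>A \<union> B\<close> misses one of the two groups only if it lies
  within the other, and then equals it because groups have three points.\<close>

lemma edges_over_pair:
  assumes "A \<in> I" "B \<in> I" "A \<noteq> B"
  shows "edges_over V I {{A, B}} = complete3 (A \<union> B) - {A, B}"
proof (intro equalityI subsetI)
  fix x assume "x \<in> edges_over V I {{A, B}}"
  then have x: "x \<subseteq> V" "card x = 3" "shadow I x = {A, B}"
    by (auto simp: edges_over_def complete3_def)
  then have "x \<subseteq> A \<union> B" using subset_Union_shadow[of x] by simp
  moreover have "A \<inter> x \<noteq> {}" "B \<inter> x \<noteq> {}" using x(3) by (auto simp: shadow_def)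
  ultimately show "x \<in> complete3 (A \<union> B) - {A, B}"
    using x(2) group_disjoint[OF assms] by (auto simp: complete3_def)
next
  fix x assume "x \<in> complete3 (A \<union> B) - {A, B}"
  then have x: "x \<subseteq> A \<union> B" "card x = 3" "x \<noteq> A" "x \<noteq> B" by (auto simp: complete3_def)
  have "\<not> x \<subseteq> A" "\<not> x \<subseteq> B"
    using x assms card_subset_eq[of A x] card_subset_eq[of B x] by (auto simp: finite_group group_card)
  then have "A \<inter> x \<noteq> {}" "B \<inter> x \<noteq> {}" using x(1) by auto
  moreover have "g \<inter> x = {}" if "g \<in> I" "g \<noteq> A" "g \<noteq> B" for g
    using group_disjoint[of g A] group_disjoint[of g B] that assms x(1) by blast
  ultimately have "shadow I x = {A, B}" using assms by (auto simp: shadow_def)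
  moreover have "x \<subseteq> V" using x(1) assms Union_groups by auto
  ultimately show "x \<in> edges_over V I {{A, B}}"
    using x(2) by (simp add: edges_over_def complete3_def)
qed

text \<open>One point chosen from each of three disjoint groups already exhausts an edge of size
  three.\<close>

lemma edges_over_triple:
  assumes "A \<in> I" "B \<in> I" "C \<in> I" "distinct [A, B, C]"
  shows "edges_over V I {{A, B, C}} = tripartite A B C"
proof (intro equalityI subsetI)
  fix x assume "x \<in> edges_over V I {{A, B, C}}"
  then have x: "card x = 3" "shadow I x = {A, B, C}"
    by (auto simp: edges_over_def complete3_def)
  then have "A \<inter> x \<noteq> {}" "B \<inter> x \<noteq> {}" "C \<inter> x \<noteq> {}" by (auto simp: shadow_def)
  then obtain a b c where abc: "a \<in> A" "b \<in> B" "c \<in> C" "{a,b,c} \<subseteq> x" by blast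
  have "a \<noteq> b" "a \<noteq> c" "b \<noteq> c"
    using abc group_disjoint[of A B] group_disjoint[of A C] group_disjoint[of B C] assms by auto
  then have "card {a,b,c} = card x" using x(1) by simp
  then have "{a,b,c} = x"
    using abc(4) x(1) by (intro card_subset_eq) (auto intro: card_ge_0_finite)
  then show "x \<in> tripartite A B C" using abc unfolding tripartite_def by blast
next
  fix x assume "x \<in> tripartite A B C"
  then obtain a b c where abc: "a \<in> A" "b \<in> B" "c \<in> C" "x = {a,b,c}"
    by (auto simp: tripartite_def)
  have "a \<noteq> b" "a \<noteq> c" "b \<noteq> c"
    using abc group_disjoint[of A B] group_disjoint[of A C] group_disjoint[of B C] assms by auto
  then have "card x = 3" using abc by simp
  moreover have "x \<subseteq> V" using abc assms Union_groups by auto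
  moreover have "shadow I x = {A, B, C}"
  proof -
    have "g = A \<or> g = B \<or> g = C" if "g \<in> I" "g \<inter> x \<noteq> {}" for g
      using that abc assms group_disjoint[of g A] group_disjoint[of g B] group_disjoint[of g C] by auto
    then show ?thesis using abc assms by (auto simp: shadow_def)
  qed
  ultimately show "x \<in> edges_over V I {{A, B, C}}"
    by (simp add: edges_over_def complete3_def)
qed

text \<open>With the common groups \<open>A\<close>, \<open>B\<close> and the remaining ones
  \<open>C\<close>, \<open>D\<close>, the two tripartite hypergraphs merge into one with third class
  \<open>C \<union> D\<close>.\<close>

lemma tileable_edges_over_adjacent_pair:
  assumes "adjacent_pair Q" "Q \<subseteq> complete3 I"
  shows "tileable six_cycle (edges_over V I Q)"
proof -
  obtain e f where ef: "Q = {e, f}" "card e = 3" "card f = 3" "card (e \<inter> f) = 2"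
    using assms(1) by (auto simp: adjacent_pair_def)
  have sub: "e \<subseteq> I" "f \<subseteq> I" using assms(2) ef(1) by (auto simp: complete3_def)
  have fin: "finite e" "finite f" using ef by (auto intro: card_ge_0_finite)
  obtain A B where AB: "e \<inter> f = {A, B}" "A \<noteq> B" using ef(4) by (auto simp: card_2_iff)
  have "card (e - f) = 1" "card (f - e) = 1"
    using ef fin by (simp_all add: card_Diff_subset_Int Int_commute)
  then obtain C D where CD: "e - f = {C}" "f - e = {D}" by (auto simp: card_1_singleton_iff)
  have e: "e = {A, B, C}" and f: "f = {A, B, D}" using AB CD by auto
  have dist: "distinct [A, B, C, D]" using AB CD by auto
  have "edges_over V I Q = edges_over V I {{A,B,C}} \<union> edges_over V I {{A,B,D}}"
    unfolding ef(1) e f edges_over_def by auto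
  also have "\<dots> = tripartite A B (C \<union> D)"
    using sub dist unfolding e f by (simp add: edges_over_triple tripartite_Un)
  finally have eq: "edges_over V I Q = tripartite A B (C \<union> D)" .
  have I: "A \<in> I" "B \<in> I" "C \<in> I" "D \<in> I" using sub unfolding e f by auto
  have "(C \<union> D) \<inter> (A \<union> B) = {}"
    using I dist distinct_rev[of "[A, B, C, D]"]
    by (simp add: Int_Un_distrib Int_Un_distrib2 group_disjoint)
  then show ?thesis
    unfolding eq using I dist by (intro tileable_K336) (simp_all add: group_card group_disjoint)
qed

lemma tileable_edges_over:
  assumes "tileable adjacent_pair F" "F \<subseteq> complete3 I"
  shows "tileable six_cycle (edges_over V I F)"
  using assms
proof (induction rule: tileable.induct)
  case empty
  show ?case by (simp add: edges_over_def tileable.empty)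
next
  case (tile Q F)
  have "edges_over V I (Q \<union> F) = edges_over V I Q \<union> edges_over V I F"
    "edges_over V I Q \<inter> edges_over V I F = {}"
    using tile.hyps by (auto simp: edges_over_def)
  moreover have "tileable six_cycle (edges_over V I Q)" "tileable six_cycle (edges_over V I F)"
    using tile by (simp_all add: tileable_edges_over_adjacent_pair)
  ultimately show ?case by (simp add: tileable_Un)
qed

text \<open>An edge meets one, two or three groups, and meets exactly one precisely when it is
  itself a group.\<close>

lemma complete3_minus_factor:
  "complete3 V - I = edges_over V I {s. s \<subseteq> I \<and> card s = 2} \<union> edges_over V I (complete3 I)"
proof (intro equalityI subsetI)
  fix x assume x: "x \<in> complete3 V - I"
  then have x': "x \<subseteq> V" "card x = 3" "finite x" by (auto simp: complete3_def intro: card_ge_0_finite)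
  \<comment> \<open>A point of \<open>x\<close> is chosen in each group that \<open>x\<close> meets.
    The groups are disjoint, so the choice is injective and at most three groups are met.\<close>
  have "\<forall>g\<in>shadow I x. \<exists>p. p \<in> x \<and> p \<in> g" by (auto simp: shadow_def)
  then obtain p where p: "\<And>g. g \<in> shadow I x \<Longrightarrow> p g \<in> x \<and> p g \<in> g" by metis
  have "inj_on p (shadow I x)"
  proof (rule inj_onI)
    fix g h assume gh: "g \<in> shadow I x" "h \<in> shadow I x" "p g = p h"
    then have "p g \<in> g \<inter> h" using p[OF gh(1)] p[OF gh(2)] by simp
    then show "g = h" using gh(1,2) group_disjoint[of g h] by (auto simp: shadow_def)
  qed
  then have "card (shadow I x) \<le> 3"
    using card_inj_on_le[of p "shadow I x" x] p x' by auto
  moreover have "card (shadow I x) \<noteq> 0"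
  proof
    assume "card (shadow I x) = 0"
    then have "shadow I x = {}" using finite_groups by (simp add: shadow_def)
    then show False using subset_Union_shadow[OF x'(1)] x'(2) by simp
  qed
  moreover have "card (shadow I x) \<noteq> 1"
  proof
    assume "card (shadow I x) = 1"
    then obtain g where g: "shadow I x = {g}" by (auto simp: card_1_singleton_iff)
    then have "g \<in> I" "x \<subseteq> g" using subset_Union_shadow[OF x'(1)] by (auto simp: shadow_def)
    then have "x = g" using x'(2) by (intro card_subset_eq) (auto simp: finite_group group_card)
    with x \<open>g \<in> I\<close> show False by simp
  qed
  ultimately have "card (shadow I x) = 2 \<or> card (shadow I x) = 3" by linarith
  moreover have "shadow I x \<subseteq> I" by (auto simp: shadow_def)
  ultimately show "x \<in> edges_over V I {s. s \<subseteq> I \<and> card s = 2} \<union> edges_over V I (complete3 I)"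
    using x by (auto simp: edges_over_def complete3_def)
next
  fix x assume x: "x \<in> edges_over V I {s. s \<subseteq> I \<and> card s = 2} \<union> edges_over V I (complete3 I)"
  then have "card (shadow I x) \<noteq> 1" by (auto simp: edges_over_def complete3_def)
  moreover have "shadow I x = {x}" if "x \<in> I"
    using that group_disjoint[of _ x] group_card[of x] by (auto simp: shadow_def)
  ultimately have "x \<notin> I" by auto
  with x show "x \<in> complete3 V - I" by (auto simp: edges_over_def)
qed

text \<open>Edges meeting two groups are tiled for any number of groups; the residue condition
  enters only through the pairing of triples of groups.\<close>

lemma tileable_complete3_minus_factor:
  assumes "card I mod 4 \<noteq> 3"
  shows "tileable six_cycle (complete3 V - I)"
proof -
  define pairs where "pairs = {s. s \<subseteq> I \<and> card s = 2}"
  have "tileable six_cycle (\<Union>s\<in>pairs. edges_over V I {s})"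
  proof (rule tileable_UN)
    show "finite pairs" using finite_groups by (simp add: pairs_def)
    show "tileable six_cycle (edges_over V I {s})" if "s \<in> pairs" for s
    proof -
      have "s \<subseteq> I" "card s = 2" using that by (simp_all add: pairs_def)
      then obtain A B where "s = {A, B}" "A \<noteq> B" "A \<in> I" "B \<in> I" unfolding card_2_iff by auto
      then show ?thesis
        by (simp add: edges_over_pair tileable_K6_minus_factor group_card group_disjoint)
    qed
  qed (auto simp: edges_over_def)
  moreover have "(\<Union>s\<in>pairs. edges_over V I {s}) = edges_over V I pairs"
    by (auto simp: edges_over_def)
  moreover have "tileable six_cycle (edges_over V I (complete3 I))"
    using tileable_complete3[OF finite_groups assms] by (rule tileable_edges_over) simp
  moreover have "edges_over V I pairs \<inter> edges_over V I (complete3 I) = {}"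
    by (auto simp: edges_over_def pairs_def complete3_def)
  ultimately show ?thesis
    using complete3_minus_factor by (simp add: tileable_Un pairs_def)
qed

section \<open>Necessity by counting edges\<close>

lemma card_complete3_minus_factor: "card (complete3 V - I) + card I = card V choose 3"
proof -
  have "I \<subseteq> complete3 V" using factor by (simp add: one_factor_def)
  moreover have "finite (complete3 V)" using fin by (simp add: complete3_def)
  moreover have "card (complete3 V) = card V choose 3"
    unfolding complete3_def using fin by (rule n_subsets)
  ultimately show ?thesis
    using card_mono[of "complete3 V" I] by (simp add: card_Diff_subset finite_groups)
qed

text \<open>With \<open>4 * j + 3\<close> groups there are \<open>12 * j + 9\<close> vertices, and
  six times the edge count fails modulo 4.\<close>

lemma six_cycle_partition_card:
  assumes "\<And>C. C \<in> D \<Longrightarrow> six_cycle C" and "\<And>C C'. C \<in> D \<Longrightarrow> C' \<in> D \<Longrightarrow> C \<noteq> C' \<Longrightarrow> C \<inter> C' = {}"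
    and "\<Union>D = complete3 V - I"
  shows "card I mod 4 \<noteq> 3"
proof
  assume "card I mod 4 = 3"
  then obtain j where j: "card I = 4 * j + 3" by (metis mult_div_mod_eq)
  have "finite (\<Union>D)" using fin assms(3) by (simp add: complete3_def)
  then have "6 * card D = card (complete3 V - I)"
    using card_partition[of D 6] assms finite_UnionD[of D] card_six_cycle by metis
  then have "6 * card D + (4 * j + 3) = (12 * j + 9) choose 3"
    using card_complete3_minus_factor card_vertices j by (simp add: algebra_simps)
  then have "36 * card D + 6 * (4 * j + 3) = 6 * ((12 * j + 9) choose 3)" by simp
  also have "\<dots> = (12 * j + 9) * (12 * j + 8) * (12 * j + 7)"
    using six_times_choose_3[of "12 * j + 9"] by (simp add: add.commute)
  finally have "36 * card D + 24 * j + 18 = 1728 * (j * j * j) + 3456 * (j * j) + 2292 * j + 504"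
    by (simp add: algebra_simps)
  \<comment> \<open>The right-hand side is divisible by 4 thanks to the factor
    \<open>12 * j + 8\<close>, while the left-hand side is 2 modulo 4 because
    \<open>6 * (4 * j + 3)\<close> is.\<close>
  then have "4 * (9 * card D + 6 * j + 4) + 2 =
    4 * (432 * (j * j * j) + 864 * (j * j) + 573 * j + 126)" by simp
  moreover have "4 * m + 2 \<noteq> 4 * n" for m n :: nat by presburger
  ultimately show False by blast
qed

end

theorem theorem2:
  fixes V :: "'a set" and I :: "'a set set" and v :: nat
  assumes "finite V" and "card V = v" and "v \<ge> 4" and "3 dvd v"
    and "one_factor V I"
  shows "(\<exists>D. tight_cycle_decomposition 6 V (complete3 V - I) D) \<longleftrightarrow>
         v mod 12 \<in> {0, 3, 6}"
proof -
  have "\<Union>(complete3 V - I) \<subseteq> V" by (auto simp: complete3_def)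
  note iff = tight_cycle_decomposition_6_iff[OF this]
  have "(\<exists>D. tight_cycle_decomposition 6 V (complete3 V - I) D) \<longleftrightarrow> card I mod 4 \<noteq> 3"
  proof
    assume "\<exists>D. tight_cycle_decomposition 6 V (complete3 V - I) D"
    then obtain D where "tight_cycle_decomposition 6 V (complete3 V - I) D" ..
    then show "card I mod 4 \<noteq> 3"
      unfolding iff by (intro six_cycle_partition_card[OF assms(1,5), of D]) simp_all
  next
    assume "card I mod 4 \<noteq> 3"
    then have "tileable six_cycle (complete3 V - I)"
      by (rule tileable_complete3_minus_factor[OF assms(1,5)])
    then show "\<exists>D. tight_cycle_decomposition 6 V (complete3 V - I) D"
    proof (rule tileable_partition)
      fix D assume "\<And>C. C \<in> D \<Longrightarrow> six_cycle C"
        "\<And>C C'. C \<in> D \<Longrightarrow> C' \<in> D \<Longrightarrow> C \<noteq> C' \<Longrightarrow> C \<inter> C' = {}" "\<Union>D = complete3 V - I"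
      then have "tight_cycle_decomposition 6 V (complete3 V - I) D" unfolding iff by simp
      then show ?thesis ..
    qed
  qed
  also have "\<dots> \<longleftrightarrow> v mod 12 \<in> {0, 3, 6}"
  proof -
    \<comment> \<open>Residues of \<open>v\<close> modulo 12 are three times those of
      \<open>card I\<close> modulo 4, so excluding 3 for \<open>card I\<close> excludes exactly 9
      for \<open>v\<close>.\<close>
    have "v = 3 * card I" using card_vertices[OF assms(1,5)] assms(2) by simp
    then have "v mod 12 = 3 * (card I mod 4)" by (simp add: mult_mod_right)
    moreover have "card I mod 4 < 4" by simp
    ultimately show ?thesis by auto
  qed
  finally show ?thesis .
qed

end
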